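(* Let $c>0$ and $a\in(0,\infty)$, and let $\alpha$ be a probability measure on $[0,c]$ such that for every $\varepsilon>0$ the measure $\alpha$ is not supported on $[0,c-\varepsilon]$ (that is, $\alpha([0,c-\varepsilon])<1$). Let $X$ be a random variable whose characteristic function is $$\mathbb{E}\,e^{iuX}=\exp\left(a\left(iu\,\alpha(\{0\})+\int_{(0,c]}\frac{e^{iuy}-1}{y}\,\alpha(dy)\right)\right),\qquad u\in\mathbb{R}.$$ Then $G(x):=\mathbb{P}(X\ge x)$ satisfies $$\lim_{x\to\infty}\frac{\log G(x)}{(x/c)\log x}=-1.$$ *)

theory Defs
  imports "HOL-Probability.Probability"
begin

end

theory Submission
  imports Defs
begin

text \<open>
  Let \<open>\<mu>\<close> be the law of \<open>X\<close>. The derivative in \<open>u\<close> of the integrand \<open>(iexp (u * y) - 1) / y\<close> is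
  \<open>\<i> * iexp (u * y)\<close>, so the exponent has derivative \<open>\<i> a char \<alpha> u\<close> and therefore
  \<open>char \<mu>' = \<i> a (char \<alpha>) (char \<mu>)\<close>. Read backwards through Fourier uniqueness this is the size-bias
  identity \<open>x \<mu>(dx) = a (\<mu> \<star> \<alpha>)(dx)\<close> (\<open>size_bias_of_levy_char\<close>): the size-biased version of \<open>X\<close> is
  \<open>X + Y\<close>, where \<open>Y\<close> has law \<open>\<alpha>\<close> and is independent of \<open>X\<close>. Both bounds for the
  tail \<open>G x = \<mu> {x..}\<close> follow by iterating it.

  As \<open>Y \<le> c\<close>, evaluating the identity on \<open>{x..}\<close> gives \<open>G x \<le> (a / x) G (x - c)\<close>.
  Iterating about \<open>x / c\<close> times, each step contributes a factor of order \<open>1 / x\<close>, hence \<open>ln (G x)\<close> is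
  at most about \<open>- (x / c) ln x\<close>.

  From below, for \<open>d < c\<close> the variable \<open>Y\<close> exceeds \<open>d\<close> with positive probability \<open>\<beta>\<close>. On an
  interval the identity gives \<open>\<mu> {l + d..<r + c} \<ge> a \<beta> / (r + c) \<mu> {l..<r}\<close>. Starting
  from \<open>{0..<H}\<close>, about \<open>x / d\<close> steps reach \<open>x\<close>, and each costs a factor of order \<open>1 / x\<close> because the
  right endpoint grows only linearly. So \<open>ln (G x)\<close> is at least about \<open>- (x / d) ln x\<close>, and \<open>d\<close>
  may be taken arbitrarily close to \<open>c\<close>.

  Two points need care before the identity is available. Moments of \<open>\<mu>\<close> have to be extracted from its
  characteristic function (\<open>second_moment_of_char\<close>). Moreover \<open>x \<mu>(dx)\<close> is a priori a signed measure;
  moving its negative part to the other side shows at once that this part vanishes, that is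
  \<open>X \<ge> 0\<close> almost surely (\<open>size_bias_of_transform\<close>).
\<close>

section \<open>Convolutions of laws on the real line\<close>

lemma integral_convolution:
  fixes f :: "real \<Rightarrow> 'b::{banach, second_countable_topology}"
  assumes "real_distribution M" "real_distribution N"
    and [measurable]: "f \<in> borel_measurable borel" and bnd: "\<And>x. norm (f x) \<le> B"
  shows "(\<integral>z. f z \<partial>(M \<star> N)) = (\<integral>x. \<integral>y. f (x + y) \<partial>N \<partial>M)"
proof -
  interpret M: real_distribution M by fact
  interpret N: real_distribution N by fact
  interpret MN: pair_prob_space M N ..
  have "integrable (M \<Otimes>\<^sub>M N) (\<lambda>(x, y). f (x + y))"
    by (rule MN.integrable_const_bound[where B=B]) (auto simp: bnd)
  from MN.integral_fst'[OF this] show ?thesis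
    unfolding convolution_def by (subst integral_distr) (auto simp: split_beta')
qed

lemma real_distribution_convolution:
  assumes "real_distribution M" "real_distribution N"
  shows "real_distribution (M \<star> N)"
proof -
  interpret M: real_distribution M by fact
  interpret N: real_distribution N by fact
  interpret MN: pair_prob_space M N ..
  show ?thesis unfolding convolution_def
    by (rule MN.real_distribution_distr) simp
qed

lemma char_convolution:
  assumes "real_distribution M" "real_distribution N"
  shows "char (M \<star> N) u = char M u * char N u"
proof -
  have "char (M \<star> N) u = (\<integral>x. \<integral>y. iexp (u * (x + y)) \<partial>N \<partial>M)"
    unfolding char_def by (rule integral_convolution[where B=1]) (use assms in auto)
  also have "\<dots> = (\<integral>x. \<integral>y. iexp (u * x) * iexp (u * y) \<partial>N \<partial>M)"
    by (simp add: exp_add[symmetric] algebra_simps)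
  also have "\<dots> = char M u * char N u"
    unfolding char_def by (simp del: of_real_mult)
  finally show ?thesis .
qed

text \<open>If \<open>X \<in> B\<close> and \<open>Y \<in> C\<close> force \<open>X + Y \<in> A\<close>, independence turns the probability of
  the first two events into a product.\<close>

lemma measure_convolution_ge:
  assumes "real_distribution M" "real_distribution N"
    and [measurable]: "A \<in> sets borel" "B \<in> sets borel" "C \<in> sets borel"
    and sub: "\<And>x y. x \<in> B \<Longrightarrow> y \<in> C \<Longrightarrow> x + y \<in> A"
  shows "measure M B * measure N C \<le> measure (M \<star> N) A"
proof -
  interpret M: real_distribution M by fact
  interpret N: real_distribution N by fact
  interpret MN: pair_prob_space M N ..
  have "measure M B * measure N C = measure (M \<Otimes>\<^sub>M N) (B \<times> C)"
    by (simp add: measure_def N.emeasure_pair_measure_Times enn2real_mult)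
  also have "\<dots> \<le> measure (M \<Otimes>\<^sub>M N) ((\<lambda>(x, y). x + y) -` A \<inter> space (M \<Otimes>\<^sub>M N))"
  proof (rule MN.finite_measure_mono)
    show "(\<lambda>(x, y). x + y) -` A \<inter> space (M \<Otimes>\<^sub>M N) \<in> sets (M \<Otimes>\<^sub>M N)"
      by (rule measurable_sets[where A=borel]) auto
  qed (auto simp: sub space_pair_measure)
  also have "\<dots> = measure (M \<star> N) A"
    unfolding convolution_def by (subst measure_distr) auto
  finally show ?thesis .
qed

text \<open>When \<open>Y\<close> lies in \<open>C\<close> almost surely, this is the product lower bound
  applied to the complements of \<open>A\<close> and \<open>B\<close>.\<close>

lemma measure_convolution_le:
  assumes "real_distribution M" "real_distribution N"
    and [measurable]: "A \<in> sets borel" "B \<in> sets borel" "C \<in> sets borel"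
    and full: "measure N C = 1"
    and sub: "\<And>x y. x + y \<in> A \<Longrightarrow> y \<in> C \<Longrightarrow> x \<in> B"
  shows "measure (M \<star> N) A \<le> measure M B"
proof -
  interpret M: real_distribution M by fact
  interpret MN: real_distribution "M \<star> N" by (rule real_distribution_convolution) fact+
  have "measure M (- B) * measure N C \<le> measure (M \<star> N) (- A)"
    by (rule measure_convolution_ge) (use assms in auto)
  then show ?thesis
    using M.prob_compl[of B] MN.prob_compl[of A] full by (simp add: Compl_eq_Diff_UNIV)
qed

section \<open>Mixtures of laws on the real line\<close>

text \<open>The law of \<open>if b then X else Y\<close> for independent \<open>X\<close>, \<open>Y\<close> and a coin \<open>b\<close>
  that shows heads with probability \<open>p\<close>; realising \<open>p P + (1 - p) Q\<close> by such a coin makes it a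
  probability measure by construction and reduces its integrals to Fubini's theorem.\<close>

definition mixture :: "real \<Rightarrow> real measure \<Rightarrow> real measure \<Rightarrow> real measure" where
  "mixture p P Q = distr (measure_pmf (bernoulli_pmf p) \<Otimes>\<^sub>M (P \<Otimes>\<^sub>M Q)) borel
     (\<lambda>(b, x, y). if b then x else y)"

lemma
  assumes "real_distribution P" "real_distribution Q" and p: "0 \<le> p" "p \<le> 1"
  shows real_distribution_mixture: "real_distribution (mixture p P Q)"
    and integral_mixture: "\<And>f :: real \<Rightarrow> 'b::{banach, second_countable_topology}.
      f \<in> borel_measurable borel \<Longrightarrow> (\<And>x. norm (f x) \<le> B) \<Longrightarrow>
      (\<integral>x. f x \<partial>mixture p P Q) = p *\<^sub>R (\<integral>x. f x \<partial>P) + (1 - p) *\<^sub>R (\<integral>x. f x \<partial>Q)"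
proof -
  interpret P: real_distribution P by fact
  interpret Q: real_distribution Q by fact
  interpret PQ: pair_prob_space P Q ..
  interpret C: prob_space "measure_pmf (bernoulli_pmf p)" by (rule prob_space_measure_pmf)
  interpret CPQ: pair_prob_space "measure_pmf (bernoulli_pmf p)" "P \<Otimes>\<^sub>M Q" ..
  have [measurable]: "(\<lambda>(b, x, y). if b then x else y) \<in>
      borel_measurable (measure_pmf (bernoulli_pmf p) \<Otimes>\<^sub>M (P \<Otimes>\<^sub>M Q))"
    by measurable
  show "real_distribution (mixture p P Q)"
    unfolding mixture_def by (rule CPQ.real_distribution_distr) measurable
  fix f :: "real \<Rightarrow> 'b" assume [measurable]: "f \<in> borel_measurable borel"
    and bnd: "\<And>x. norm (f x) \<le> B"
  have "integrable (P \<Otimes>\<^sub>M Q) (\<lambda>z. f (fst z))"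
    by (rule PQ.integrable_const_bound[where B=B]) (simp_all add: bnd)
  from PQ.integral_fst'[OF this] have fP: "(\<integral>z. f (fst z) \<partial>(P \<Otimes>\<^sub>M Q)) = (\<integral>x. f x \<partial>P)"
    using Q.prob_space by simp
  have "integrable (P \<Otimes>\<^sub>M Q) (\<lambda>z. f (snd z))"
    by (rule PQ.integrable_const_bound[where B=B]) (simp_all add: bnd)
  from PQ.integral_fst'[OF this] have fQ: "(\<integral>z. f (snd z) \<partial>(P \<Otimes>\<^sub>M Q)) = (\<integral>x. f x \<partial>Q)"
    using P.prob_space by simp
  have "(\<integral>x. f x \<partial>mixture p P Q) =
      (\<integral>w. f (if fst w then fst (snd w) else snd (snd w)) \<partial>(measure_pmf (bernoulli_pmf p) \<Otimes>\<^sub>M (P \<Otimes>\<^sub>M Q)))"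
    unfolding mixture_def by (subst integral_distr) (auto simp: split_beta')
  also have "\<dots> = (\<integral>b. \<integral>z. f (if b then fst z else snd z) \<partial>(P \<Otimes>\<^sub>M Q) \<partial>measure_pmf (bernoulli_pmf p))"
  proof -
    have "integrable (measure_pmf (bernoulli_pmf p) \<Otimes>\<^sub>M (P \<Otimes>\<^sub>M Q))
        (\<lambda>w. f (if fst w then fst (snd w) else snd (snd w)))"
      by (rule CPQ.integrable_const_bound[where B=B]) (simp_all add: bnd)
    from CPQ.integral_fst'[OF this, symmetric] show ?thesis unfolding fst_conv snd_conv .
  qed
  also have "\<dots> = (\<integral>b. (if b then \<integral>x. f x \<partial>P else \<integral>x. f x \<partial>Q) \<partial>measure_pmf (bernoulli_pmf p))"
    by (intro Bochner_Integration.integral_cong) (auto simp: fP fQ)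
  also have "\<dots> = p *\<^sub>R (\<integral>x. f x \<partial>P) + (1 - p) *\<^sub>R (\<integral>x. f x \<partial>Q)"
    by (subst integral_measure_pmf[of UNIV]) (use p in \<open>auto simp: UNIV_bool\<close>)
  finally show "(\<integral>x. f x \<partial>mixture p P Q) = p *\<^sub>R (\<integral>x. f x \<partial>P) + (1 - p) *\<^sub>R (\<integral>x. f x \<partial>Q)" .
qed

section \<open>Moments and derivatives of characteristic functions\<close>

text \<open>Both the characteristic function and its exponent are differentiated under the integral
  sign by means of a uniform quadratic error bound, so no domination argument is needed.\<close>

lemma has_vector_derivative_quadratic_remainder:
  fixes f :: "real \<Rightarrow> 'b::real_normed_vector"
  assumes "\<And>h. norm (f (u + h) - f u - h *\<^sub>R D) \<le> C * h\<^sup>2"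
  shows "(f has_vector_derivative D) (at u)"
  unfolding has_vector_derivative_def has_derivative_at
proof (intro conjI)
  show "bounded_linear (\<lambda>h. h *\<^sub>R D)" by (rule bounded_linear_scaleR_left)
  have "((\<lambda>h. C * \<bar>h\<bar>) \<longlongrightarrow> 0) (at 0)"
    by (rule tendsto_eq_intros | simp)+
  then show "(\<lambda>h. norm (f (u + h) - f u - h *\<^sub>R D) / norm h) \<midarrow>0\<rightarrow> 0"
  proof (rule Lim_null_comparison[rotated])
    show "\<forall>\<^sub>F h in at 0. norm (norm (f (u + h) - f u - h *\<^sub>R D) / norm h) \<le> C * \<bar>h\<bar>"
      using assms by (auto simp: eventually_at_filter field_simps power2_eq_square abs_mult_self_eq)
  qed
qed

lemma iexp_increment_bound:
  fixes u h y :: real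
  shows "norm (iexp ((u + h) * y) - iexp (u * y) - h *\<^sub>R (\<i> * y * iexp (u * y))) \<le> (h * y)\<^sup>2 / 2"
proof -
  have "iexp ((u + h) * y) - iexp (u * y) - h *\<^sub>R (\<i> * y * iexp (u * y))
      = iexp (u * y) * (iexp (h * y) - (\<Sum>k\<le>1. (\<i> * (h * y))^k / fact k))"
    by (simp add: algebra_simps exp_add[symmetric] scaleR_conv_of_real)
  then have "norm (iexp ((u + h) * y) - iexp (u * y) - h *\<^sub>R (\<i> * y * iexp (u * y)))
      = norm (iexp (h * y) - (\<Sum>k\<le>1. (\<i> * (h * y))^k / fact k))"
    by (simp add: norm_mult del: of_real_mult)
  also have "\<dots> \<le> (h * y)\<^sup>2 / 2"
    using iexp_approx1[of "h * y" 1] by (simp add: power2_abs numeral_2_eq_2)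
  finally show ?thesis .
qed

lemma has_vector_derivative_char:
  assumes "real_distribution M" and sq: "integrable M (\<lambda>x. x\<^sup>2)"
  shows "integrable M (\<lambda>x. x)"
    and "(char M has_vector_derivative \<i> * (CLINT x|M. x * iexp (u * x))) (at u)"
proof -
  interpret real_distribution M by fact
  show int1: "integrable M (\<lambda>x. x)"
    by (rule square_integrable_imp_integrable[OF _ sq]) simp
  let ?D = "\<lambda>x. \<i> * complex_of_real x * iexp (u * x)"
  have i0: "integrable M (\<lambda>x. iexp (v * x))" for v
    by (rule integrable_const_bound[where B=1]) (auto simp del: of_real_mult)
  have iD: "integrable M ?D"
    by (rule Bochner_Integration.integrable_bound[OF int1]) (auto simp: norm_mult simp del: of_real_mult)
  have "(char M has_vector_derivative (CLINT x|M. ?D x)) (at u)"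
  proof (rule has_vector_derivative_quadratic_remainder[where C="(\<integral>x. x\<^sup>2 \<partial>M) / 2"])
    fix h :: real
    have "char M (u + h) - char M u - h *\<^sub>R (CLINT x|M. ?D x)
        = (CLINT x|M. iexp ((u + h) * x) - iexp (u * x) - h *\<^sub>R ?D x)"
      unfolding char_def using i0[of "u+h"] i0[of u] iD by (simp del: of_real_mult)
    also have "norm \<dots> \<le> (\<integral>x. (h * x)\<^sup>2 / 2 \<partial>M)"
      by (rule order_trans[OF integral_norm_bound integral_mono])
        (use i0[of "u+h"] i0[of u] iD sq iexp_increment_bound[of u h] in
          \<open>auto simp: power_mult_distrib simp del: of_real_mult of_real_add\<close>)
    also have "\<dots> = (\<integral>x. x\<^sup>2 \<partial>M) / 2 * h\<^sup>2"
      by (simp add: power_mult_distrib)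
    finally show "norm (char M (u + h) - char M u - h *\<^sub>R (CLINT x|M. ?D x)) \<le> (\<integral>x. x\<^sup>2 \<partial>M) / 2 * h\<^sup>2" .
  qed
  also have "(CLINT x|M. ?D x) = \<i> * (CLINT x|M. x * iexp (u * x))"
    by (simp add: mult.assoc del: of_real_mult)
  finally show "(char M has_vector_derivative \<i> * (CLINT x|M. x * iexp (u * x))) (at u)" .
qed

text \<open>By Fatou's lemma, since \<open>2 (1 - cos (h x)) / h\<^sup>2\<close> tends to \<open>x\<^sup>2\<close> as \<open>h\<close> tends to zero and
  the integral of \<open>1 - cos (h x)\<close> is \<open>1 - Re (char M h)\<close>. The law in question is
  known only through its characteristic function, and this is where its moments come from.\<close>

lemma second_moment_of_char:
  assumes "real_distribution M" and K: "\<And>h. 1 - Re (char M h) \<le> K * h\<^sup>2"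
  shows "integrable M (\<lambda>x. x\<^sup>2)"
proof -
  interpret real_distribution M by fact
  define q :: "nat \<Rightarrow> real \<Rightarrow> real" where "q n x = 2 * (1 - cos (x / real (Suc n))) * (real (Suc n))\<^sup>2" for n x
  have [measurable]: "q n \<in> borel_measurable borel" for n unfolding q_def by measurable
  have q0: "0 \<le> q n x" for n x unfolding q_def by simp
  have lim: "(\<lambda>n. q n x) \<longlonglongrightarrow> x\<^sup>2" for x
  proof (cases "x = 0")
    case False
    have "(\<lambda>n. q n x) \<longlonglongrightarrow> x\<^sup>2" if "x > 0" for x using that unfolding q_def by (real_asymp simp: power2_eq_square)
    from this[of "\<bar>x\<bar>"] False show ?thesis by (cases "x > 0") (auto simp: q_def)
  qed (simp add: q_def)
  have qint: "(\<integral>\<^sup>+x. ennreal (q n x) \<partial>M) \<le> ennreal (2 * K)" for n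
  proof -
    let ?h = "1 / real (Suc n)"
    have i0: "integrable M (\<lambda>x. iexp (?h * x))"
      by (rule integrable_const_bound[where B=1]) (auto simp del: of_real_mult)
    have ic: "integrable M (\<lambda>x. cos (?h * x))"
      by (rule integrable_const_bound[where B=1]) auto
    have "Re (char M ?h) = (\<integral>x. cos (?h * x) \<partial>M)"
      unfolding char_def using integral_Re[OF i0] by (simp add: Re_exp del: of_real_mult)
    with K[of ?h] have "1 - (\<integral>x. cos (?h * x) \<partial>M) \<le> K * ?h\<^sup>2" by simp
    from mult_right_mono[OF this, of "2 * (real (Suc n))\<^sup>2"]
    have "2 * (1 - (\<integral>x. cos (?h * x) \<partial>M)) * (real (Suc n))\<^sup>2 \<le> 2 * K * (?h * real (Suc n))\<^sup>2"
      by (simp only: power_mult_distrib) (simp add: mult_ac)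
    then have "2 * (1 - (\<integral>x. cos (?h * x) \<partial>M)) * (real (Suc n))\<^sup>2 \<le> 2 * K"
      by simp
    moreover have "(\<integral>x. q n x \<partial>M) = 2 * (1 - (\<integral>x. cos (?h * x) \<partial>M)) * (real (Suc n))\<^sup>2"
      unfolding q_def using ic prob_space by simp
    moreover have "integrable M (q n)"
      unfolding q_def using ic by simp
    ultimately show ?thesis
      by (subst nn_integral_eq_integral) (auto simp: q0 ennreal_leI)
  qed
  have "(\<integral>\<^sup>+x. ennreal (x\<^sup>2) \<partial>M) = (\<integral>\<^sup>+x. liminf (\<lambda>n. ennreal (q n x)) \<partial>M)"
    by (intro nn_integral_cong sym[OF lim_imp_Liminf]) (auto intro!: tendsto_ennrealI lim)
  also have "\<dots> \<le> liminf (\<lambda>n. \<integral>\<^sup>+x. ennreal (q n x) \<partial>M)"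
    by (rule nn_integral_liminf) measurable
  also have "\<dots> \<le> liminf (\<lambda>n. ennreal (2 * K))"
    by (rule Liminf_mono) (auto simp: qint)
  also have "\<dots> < \<infinity>" by (simp add: Liminf_const)
  finally show ?thesis by (intro integrableI_bounded) auto
qed

section \<open>Size biasing from the Fourier transform\<close>

text \<open>Reweighting a law by a nonnegative integrable function. Dividing by the total mass makes the result a
  probability law, so that the uniqueness theorem for characteristic functions applies to it.\<close>

lemma
  fixes w :: "real \<Rightarrow> real" and m u :: real
  assumes "real_distribution M" and w: "integrable M w" "\<And>x. 0 \<le> w x"
    and m: "(\<integral>x. w x \<partial>M) = m" "m > 0"
  shows real_distribution_weighted: "real_distribution (density M (\<lambda>x. w x / m))"
    and char_weighted: "char (density M (\<lambda>x. w x / m)) u = (CLINT x|M. w x * iexp (u * x)) / m"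
    and measure_weighted: "A \<in> sets borel \<Longrightarrow>
          measure (density M (\<lambda>x. w x / m)) A = (\<integral>x. w x * indicator A x \<partial>M) / m"
proof -
  interpret real_distribution M by fact
  have [measurable]: "w \<in> borel_measurable borel"
    using borel_measurable_integrable[OF w(1)] by simp
  have em: "emeasure (density M (\<lambda>x. w x / m)) A = ennreal ((\<integral>x. w x * indicator A x \<partial>M) / m)"
    if [measurable]: "A \<in> sets borel" for A
  proof -
    have i: "integrable M (\<lambda>x. w x * indicator A x)"
      by (rule Bochner_Integration.integrable_bound[OF w(1)]) (auto simp: indicator_def)
    have "emeasure (density M (\<lambda>x. w x / m)) A = (\<integral>\<^sup>+x. ennreal (w x * indicator A x / m) \<partial>M)"
      by (subst emeasure_density) (auto intro!: nn_integral_cong split: split_indicator)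
    also have "\<dots> = ennreal (\<integral>x. w x * indicator A x / m \<partial>M)"
      by (rule nn_integral_eq_integral) (use i m w in auto)
    finally show ?thesis by simp
  qed
  show "real_distribution (density M (\<lambda>x. w x / m))"
    unfolding real_distribution_def real_distribution_axioms_def
    using em[of UNIV] m by (auto intro!: prob_spaceI)
  show "measure (density M (\<lambda>x. w x / m)) A = (\<integral>x. w x * indicator A x \<partial>M) / m"
    if "A \<in> sets borel"
    using em[OF that] w m by (simp add: measure_def)
  show "char (density M (\<lambda>x. w x / m)) u = (CLINT x|M. w x * iexp (u * x)) / m"
    unfolding char_def
    by (subst integral_density) (use w m in \<open>auto simp: scaleR_conv_of_real simp del: of_real_mult\<close>)
qed

text \<open>The hypothesis says that the signed measure \<open>x M(dx)\<close> and the positive measure \<open>a P\<close> have the same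
  Fourier transform. Uniqueness is available for probability measures only, so the negative part
  \<open>n\<close> of \<open>x\<close> is moved to the other side: \<open>p M = n M + a P\<close>, where both sides have mass
  \<open>mp = mn + a\<close>. After division by \<open>mp\<close> the right-hand side is a mixture, and the two laws agree. The left
  one gives no mass to the negative half-line, whereas the right one gives it at least
  \<open>mn / mp\<close>; hence \<open>mn = 0\<close> and nonnegativity comes as a by-product.\<close>

lemma size_bias_of_transform:
  assumes "real_distribution M" "real_distribution P" and int: "integrable M (\<lambda>x. x)" and "a > 0"
    and tr: "\<And>u. (CLINT x|M. x * iexp (u * x)) = a * char P u"
  shows "AE x in M. 0 \<le> x"
    and "A \<in> sets borel \<Longrightarrow> (\<integral>x. x * indicator A x \<partial>M) = a * measure P A"
proof -
  interpret M: real_distribution M by fact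
  interpret P: real_distribution P by fact
  define p n where "p = (\<lambda>x::real. max x 0)" and "n = (\<lambda>x::real. max (- x) 0)"
  have pn: "p x - n x = x" for x by (auto simp: p_def n_def)
  have ip: "integrable M p" and i_n: "integrable M n"
    unfolding p_def n_def using int by auto
  have nn: "0 \<le> p x" "0 \<le> n x" for x by (auto simp: p_def n_def)
  define mp mn where "mp = (\<integral>x. p x \<partial>M)" and "mn = (\<integral>x. n x \<partial>M)"
  have ipc: "integrable M (\<lambda>x. p x * iexp (u * x))" for u
    by (rule Bochner_Integration.integrable_bound[OF ip])
      (auto simp: norm_mult p_def simp del: of_real_mult)
  have inc: "integrable M (\<lambda>x. n x * iexp (u * x))" for u
    by (rule Bochner_Integration.integrable_bound[OF i_n])
      (auto simp: norm_mult n_def simp del: of_real_mult)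
  have tr': "(CLINT x|M. p x * iexp (u * x)) = (CLINT x|M. n x * iexp (u * x)) + a * char P u" for u
  proof -
    have "a * char P u = (CLINT x|M. p x * iexp (u * x) - n x * iexp (u * x))"
      unfolding tr[symmetric] left_diff_distrib[symmetric] of_real_diff[symmetric] pn ..
    also have "\<dots> = (CLINT x|M. p x * iexp (u * x)) - (CLINT x|M. n x * iexp (u * x))"
      by (rule Bochner_Integration.integral_diff[OF ipc inc])
    finally show ?thesis by simp
  qed
  have mass: "mp = mn + a"
  proof -
    have "complex_of_real mp = complex_of_real (mn + a)"
      using tr'[of 0] by (simp add: mp_def mn_def P.char_zero)
    then show ?thesis by (simp only: of_real_eq_iff)
  qed
  have "mn \<ge> 0" unfolding mn_def by (rule integral_nonneg_AE) (simp add: nn)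
  with mass \<open>a > 0\<close> have "mp > 0" by simp
  let ?P1 = "density M (\<lambda>x. p x / mp)"
  note P1 = real_distribution_weighted[OF \<open>real_distribution M\<close> ip nn(1) mp_def[symmetric] \<open>mp > 0\<close>]
    char_weighted[OF \<open>real_distribution M\<close> ip nn(1) mp_def[symmetric] \<open>mp > 0\<close>]
    measure_weighted[OF \<open>real_distribution M\<close> ip nn(1) mp_def[symmetric] \<open>mp > 0\<close>]
  have "mn = 0"
  proof (rule ccontr)
    assume "mn \<noteq> 0"
    with \<open>mn \<ge> 0\<close> have "mn > 0" by simp
    let ?P2 = "density M (\<lambda>x. n x / mn)"
    note P2 = real_distribution_weighted[OF \<open>real_distribution M\<close> i_n nn(2) mn_def[symmetric] \<open>mn > 0\<close>]
      char_weighted[OF \<open>real_distribution M\<close> i_n nn(2) mn_def[symmetric] \<open>mn > 0\<close>]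
      measure_weighted[OF \<open>real_distribution M\<close> i_n nn(2) mn_def[symmetric] \<open>mn > 0\<close>]
    define q where "q = mn / mp"
    have q: "0 \<le> q" "q \<le> 1" "q > 0" and q1: "1 - q = a / mp"
      using \<open>mn > 0\<close> \<open>mp > 0\<close> \<open>a > 0\<close> mass by (auto simp: q_def field_simps)
    note mix = real_distribution_mixture[OF P2(1) \<open>real_distribution P\<close> q(1,2)]
      integral_mixture[OF P2(1) \<open>real_distribution P\<close> q(1,2), where B=1]
    have "char (mixture q ?P2 P) u = char ?P1 u" for u
    proof -
      have "char (mixture q ?P2 P) u = q *\<^sub>R char ?P2 u + (1 - q) *\<^sub>R char P u"
        unfolding char_def by (rule mix(2)) (auto simp del: of_real_mult)
      also have "\<dots> = ((CLINT x|M. n x * iexp (u * x)) + a * char P u) / mp"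
        unfolding P2(2) q1 unfolding q_def using \<open>mn > 0\<close> \<open>mp > 0\<close>
        by (simp add: scaleR_conv_of_real field_simps del: of_real_mult)
      also have "\<dots> = char ?P1 u"
        unfolding P1(2) tr' ..
      finally show ?thesis .
    qed
    then have eq: "mixture q ?P2 P = ?P1"
      by (intro Levy_uniqueness mix(1) P1(1)) auto
    have "(\<integral>x. p x * indicator {..<0} x \<partial>M) = (\<integral>x. 0 \<partial>M)"
      by (intro Bochner_Integration.integral_cong) (auto simp: p_def split: split_indicator)
    then have "measure ?P1 {..<0} = 0"
      by (simp add: P1(3))
    moreover have "measure (mixture q ?P2 P) {..<0} = q * measure ?P2 {..<0} + (1 - q) * measure P {..<0}"
    proof -
      interpret Q: real_distribution "mixture q ?P2 P" by (rule mix(1))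
      have "norm (indicator {..<0::real} x :: real) \<le> 1" for x by (simp split: split_indicator)
      from mix(2)[of "indicator {..<0} :: real \<Rightarrow> real", OF _ this] show ?thesis by simp
    qed
    moreover have "measure ?P2 {..<0} = 1"
    proof -
      have "(\<integral>x. n x * indicator {..<0} x \<partial>M) = mn"
        unfolding mn_def by (intro Bochner_Integration.integral_cong) (auto simp: n_def split: split_indicator)
      with \<open>mn > 0\<close> show ?thesis by (simp add: P2(3))
    qed
    ultimately have "q + (1 - q) * measure P {..<0} = 0"
      using eq by simp
    moreover have "0 \<le> (1 - q) * measure P {..<0}" using q by simp
    ultimately show False using \<open>q > 0\<close> by linarith
  qed
  then have "AE x in M. n x = 0"
    using integral_nonneg_eq_0_iff_AE[OF i_n] by (simp add: mn_def nn)
  then show pos: "AE x in M. 0 \<le> x"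
    by eventually_elim (simp add: n_def max_def split: if_splits)
  have "mp = a" using mass \<open>mn = 0\<close> by simp
  have n0: "(CLINT x|M. n x * iexp (u * x)) = 0" for u
    by (rule integral_eq_zero_AE) (use \<open>AE x in M. n x = 0\<close> in eventually_elim, simp)
  have "char ?P1 u = char P u" for u
    unfolding P1(2) tr' n0 using \<open>mp = a\<close> \<open>a > 0\<close> by simp
  then have "?P1 = P"
    by (intro Levy_uniqueness P1(1) \<open>real_distribution P\<close>) auto
  moreover assume A[measurable]: "A \<in> sets borel"
  moreover have "(\<integral>x. x * indicator A x \<partial>M) = (\<integral>x. p x * indicator A x \<partial>M)"
  proof (rule integral_cong_AE)
    show "AE x in M. x * indicator A x = p x * indicator A x"
      using pos by eventually_elim (simp add: p_def)
  qed (auto simp: p_def)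
  ultimately show "(\<integral>x. x * indicator A x \<partial>M) = a * measure P A"
    using P1(3)[OF A] \<open>mp = a\<close> \<open>a > 0\<close> by simp
qed

section \<open>The exponent of the characteristic function\<close>

text \<open>The integrand of the exponent, extended continuously to \<open>y = 0\<close>. With this value the drift term,
  which carries the atom of \<open>\<alpha>\<close> at zero, is absorbed into the integral.\<close>

definition levy_kernel :: "real \<Rightarrow> real \<Rightarrow> complex" where
  "levy_kernel u y = (if y = 0 then \<i> * u else (iexp (u * y) - 1) / y)"

lemma levy_kernel_measurable [measurable]: "levy_kernel u \<in> borel_measurable borel"
  unfolding levy_kernel_def by measurable

lemma levy_kernel_zero [simp]: "levy_kernel 0 y = 0"
  by (simp add: levy_kernel_def)

lemma norm_iexp_diff_one_le: "norm (iexp x - 1) \<le> \<bar>x\<bar>"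
  using iexp_approx1[of x 0] by simp

lemma norm_levy_kernel_le: "norm (levy_kernel u y) \<le> \<bar>u\<bar>"
proof (cases "y = 0")
  case False
  then show ?thesis
    using norm_iexp_diff_one_le[of "u * y"]
    by (simp add: levy_kernel_def norm_divide abs_mult field_simps)
qed (simp add: levy_kernel_def norm_mult)

text \<open>The derivative of the kernel in \<open>u\<close> is \<open>\<i> * iexp (u * y)\<close> for every \<open>y\<close>, zero included: the
  division by \<open>y\<close> cancels the factor that the exponential produces. This is why the exponent has
  derivative \<open>\<i> * char \<alpha> u\<close>.\<close>

lemma levy_kernel_increment_bound:
  "norm (levy_kernel (u + h) y - levy_kernel u y - h *\<^sub>R (\<i> * iexp (u * y))) \<le> \<bar>y\<bar> / 2 * h\<^sup>2"
proof (cases "y = 0")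
  case False
  have "levy_kernel (u + h) y - levy_kernel u y - h *\<^sub>R (\<i> * iexp (u * y))
      = (iexp ((u + h) * y) - iexp (u * y) - h *\<^sub>R (\<i> * y * iexp (u * y))) / y"
    using False by (simp add: levy_kernel_def scaleR_conv_of_real field_simps del: of_real_mult of_real_add)
  also have "norm \<dots> \<le> ((h * y)\<^sup>2 / 2) / \<bar>y\<bar>"
    unfolding norm_divide norm_of_real
    by (rule divide_right_mono[OF iexp_increment_bound]) simp
  also have "\<dots> = \<bar>y\<bar> / 2 * h\<^sup>2"
    using False by (simp add: power2_eq_square field_simps abs_if)
  finally show ?thesis .
qed (simp add: levy_kernel_def scaleR_conv_of_real algebra_simps)

lemma levy_exponent_eq_integral:
  assumes "real_distribution \<alpha>" and supp: "measure \<alpha> {0..c} = 1"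
  shows "\<i> * of_real u * of_real (measure \<alpha> {0})
      + (CLINT y:{0<..c}|\<alpha>. (iexp (u * y) - 1) / of_real y) = (CLINT y|\<alpha>. levy_kernel u y)"
proof -
  interpret real_distribution \<alpha> by fact
  have AE: "AE y in \<alpha>. y \<in> {0..c}"
    using prob_eq_1[of "{0..c}"] supp by simp
  have i1: "integrable \<alpha> (\<lambda>y. indicator {0} y *\<^sub>R (\<i> * of_real u))"
    by (rule integrable_const_bound[where B="\<bar>u\<bar>"]) (auto simp: norm_mult split: split_indicator)
  have i2: "integrable \<alpha> (\<lambda>y. indicator {0<..c} y *\<^sub>R levy_kernel u y)"
    by (rule integrable_const_bound[where B="\<bar>u\<bar>"])
      (auto simp: norm_levy_kernel_le split: split_indicator)
  have "(CLINT y|\<alpha>. levy_kernel u y)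
      = (CLINT y|\<alpha>. indicator {0} y *\<^sub>R (\<i> * of_real u) + indicator {0<..c} y *\<^sub>R levy_kernel u y)"
  proof (rule integral_cong_AE)
    show "AE y in \<alpha>. levy_kernel u y
        = indicator {0} y *\<^sub>R (\<i> * of_real u) + indicator {0<..c} y *\<^sub>R levy_kernel u y"
      using AE by eventually_elim (auto simp: levy_kernel_def split: split_indicator)
  qed auto
  also have "\<dots> = (CLINT y|\<alpha>. indicator {0} y *\<^sub>R (\<i> * of_real u))
      + (CLINT y|\<alpha>. indicator {0<..c} y *\<^sub>R levy_kernel u y)"
    by (rule Bochner_Integration.integral_add[OF i1 i2])
  also have "(CLINT y|\<alpha>. indicator {0} y *\<^sub>R (\<i> * of_real u)) = \<i> * of_real u * of_real (measure \<alpha> {0})"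
    by (simp add: scaleR_conv_of_real)
  also have "(CLINT y|\<alpha>. indicator {0<..c} y *\<^sub>R levy_kernel u y)
      = (CLINT y:{0<..c}|\<alpha>. (iexp (u * y) - 1) / of_real y)"
    unfolding set_lebesgue_integral_def
    by (intro Bochner_Integration.integral_cong) (auto simp: levy_kernel_def split: split_indicator)
  finally show ?thesis by simp
qed

lemma
  assumes "real_distribution \<alpha>" and supp: "measure \<alpha> {0..c} = 1"
  shows norm_levy_exponent_le: "norm (CLINT y|\<alpha>. levy_kernel u y) \<le> \<bar>u\<bar>"
    and levy_exponent_increment_bound:
      "norm ((CLINT y|\<alpha>. levy_kernel (u + h) y) - (CLINT y|\<alpha>. levy_kernel u y)
        - h *\<^sub>R (\<i> * char \<alpha> u)) \<le> c / 2 * h\<^sup>2"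
proof -
  interpret real_distribution \<alpha> by fact
  have AE: "AE y in \<alpha>. y \<in> {0..c}"
    using prob_eq_1[of "{0..c}"] supp by simp
  have ik: "integrable \<alpha> (levy_kernel v)" for v
    by (rule integrable_const_bound[where B="\<bar>v\<bar>"]) (auto simp: norm_levy_kernel_le)
  have i0: "integrable \<alpha> (\<lambda>y. iexp (u * y))"
    by (rule integrable_const_bound[where B=1]) (auto simp del: of_real_mult)
  have "norm (CLINT y|\<alpha>. levy_kernel u y) \<le> (\<integral>y. \<bar>u\<bar> \<partial>\<alpha>)"
    by (rule order_trans[OF integral_norm_bound integral_mono])
      (use ik in \<open>auto simp: norm_levy_kernel_le\<close>)
  then show "norm (CLINT y|\<alpha>. levy_kernel u y) \<le> \<bar>u\<bar>"
    using prob_space by simp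
  let ?R = "\<lambda>y. levy_kernel (u + h) y - levy_kernel u y - h *\<^sub>R (\<i> * iexp (u * y))"
  have iR: "integrable \<alpha> ?R"
    by (intro Bochner_Integration.integrable_diff integrable_scaleR_right integrable_mult_right ik i0)
  have "(CLINT y|\<alpha>. levy_kernel (u + h) y) - (CLINT y|\<alpha>. levy_kernel u y) - h *\<^sub>R (\<i> * char \<alpha> u)
      = (CLINT y|\<alpha>. ?R y)"
    unfolding char_def using ik[of "u+h"] ik[of u] i0 by (simp del: of_real_mult)
  also have "norm \<dots> \<le> (\<integral>y. c / 2 * h\<^sup>2 \<partial>\<alpha>)"
  proof (rule order_trans[OF integral_norm_bound integral_mono_AE])
    show "AE y in \<alpha>. norm (?R y) \<le> c / 2 * h\<^sup>2"
      using AE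
    proof eventually_elim
      case (elim y)
      have "norm (?R y) \<le> \<bar>y\<bar> / 2 * h\<^sup>2" by (rule levy_kernel_increment_bound)
      also have "\<dots> \<le> c / 2 * h\<^sup>2" using elim by (intro mult_right_mono) auto
      finally show ?case .
    qed
  qed (use iR in \<open>auto intro: integrable_norm\<close>)
  also have "\<dots> = c / 2 * h\<^sup>2" using prob_space by simp
  finally show "norm ((CLINT y|\<alpha>. levy_kernel (u + h) y) - (CLINT y|\<alpha>. levy_kernel u y)
        - h *\<^sub>R (\<i> * char \<alpha> u)) \<le> c / 2 * h\<^sup>2" .
qed

text \<open>Writing \<open>1 - Re (exp z) = (1 - exp (Re z)) + exp (Re z) * (1 - cos (Im z))\<close>, both summands are
  small as soon as \<open>exp (Re z) \<le> 1\<close>. Only the real part of \<open>z\<close> enters to first order; in the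
  application it is quadratically small although \<open>z\<close> itself is not.\<close>

lemma one_minus_Re_exp_le:
  assumes "norm (exp z) \<le> 1"
  shows "1 - Re (exp z) \<le> \<bar>Re z\<bar> + (norm z)\<^sup>2 / 2"
proof -
  have r: "exp (Re z) \<le> 1" using assms by simp
  have "1 - cos (Im z) \<le> (Im z)\<^sup>2 / 2"
    using iexp_increment_bound[of 0 "Im z" 1] abs_Re_le_cmod[of "iexp (Im z) - 1 - Im z *\<^sub>R \<i>"]
    by (simp add: Re_exp)
  also have "\<dots> \<le> (norm z)\<^sup>2 / 2"
    using abs_Im_le_cmod[of z] by (simp add: abs_le_square_iff[symmetric])
  finally have "exp (Re z) * (1 - cos (Im z)) \<le> (norm z)\<^sup>2 / 2"
    using mult_right_mono[OF r, of "1 - cos (Im z)"] by simp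
  moreover have "1 - exp (Re z) \<le> \<bar>Re z\<bar>"
    using exp_ge_add_one_self[of "Re z"] by linarith
  ultimately show ?thesis by (simp add: Re_exp algebra_simps)
qed

text \<open>The exponent \<open>a \<Psi>\<close> has derivative \<open>\<i> a char \<alpha>\<close>, so differentiating \<open>char \<mu> = exp (a \<Psi>)\<close> gives
  \<open>char \<mu>' = \<i> a (char \<alpha>) (char \<mu>)\<close>. The left-hand side is \<open>\<i>\<close> times the transform of \<open>x \<mu>(dx)\<close>, the right-hand
  side \<open>\<i> a\<close> times the transform of \<open>\<mu> \<star> \<alpha>\<close>. That \<open>\<mu>\<close> has a second moment, which licenses the
  first of these identifications, follows because \<open>\<Psi> h\<close> equals \<open>\<i> h\<close> up to an error of order \<open>h\<^sup>2\<close>.\<close>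

lemma
  fixes \<mu> \<alpha> :: "real measure" and a c :: real
  assumes "real_distribution \<mu>" and "real_distribution \<alpha>" and supp: "measure \<alpha> {0..c} = 1"
    and a: "a > 0"
    and char: "\<And>u. char \<mu> u = exp (a * (CLINT y|\<alpha>. levy_kernel u y))"
  shows integrable_of_levy_char: "integrable \<mu> (\<lambda>x. x)"
    and nonneg_of_levy_char: "AE x in \<mu>. 0 \<le> x"
    and size_bias_of_levy_char: "A \<in> sets borel \<Longrightarrow> (\<integral>x. x * indicator A x \<partial>\<mu>) = a * measure (\<mu> \<star> \<alpha>) A"
proof -
  interpret real_distribution \<mu> by fact
  interpret \<alpha>: real_distribution \<alpha> by fact
  define \<Psi> where "\<Psi> u = (CLINT y|\<alpha>. levy_kernel u y)" for u
  note b = norm_levy_exponent_le[OF \<open>real_distribution \<alpha>\<close> supp, folded \<Psi>_def]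
    levy_exponent_increment_bound[OF \<open>real_distribution \<alpha>\<close> supp, folded \<Psi>_def]
  have ch: "char \<mu> u = exp (a * \<Psi> u)" for u unfolding \<Psi>_def by (rule char)
  have "1 - Re (char \<mu> h) \<le> (a * c / 2 + a\<^sup>2 / 2) * h\<^sup>2" for h
  proof -
    have "\<Psi> 0 = 0" unfolding \<Psi>_def by (simp cong: Bochner_Integration.integral_cong)
    with b(2)[of 0 h] have "norm (\<Psi> h - h *\<^sub>R \<i>) \<le> c / 2 * h\<^sup>2" by (simp add: \<alpha>.char_zero)
    then have "\<bar>Re (\<Psi> h)\<bar> \<le> c / 2 * h\<^sup>2"
      using abs_Re_le_cmod[of "\<Psi> h - h *\<^sub>R \<i>"] by simp
    then have 1: "\<bar>Re (a * \<Psi> h)\<bar> \<le> a * c / 2 * h\<^sup>2"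
      using a by (simp add: abs_mult)
    have "norm (a * \<Psi> h) \<le> a * \<bar>h\<bar>" using b(1)[of h] a by (simp add: norm_mult)
    then have 2: "(norm (a * \<Psi> h))\<^sup>2 \<le> a\<^sup>2 * h\<^sup>2"
      using power_mono[of "norm (a * \<Psi> h)" "a * \<bar>h\<bar>" 2] by (simp add: power_mult_distrib)
    have "1 - Re (exp (a * \<Psi> h)) \<le> \<bar>Re (a * \<Psi> h)\<bar> + (norm (a * \<Psi> h))\<^sup>2 / 2"
      by (rule one_minus_Re_exp_le) (use cmod_char_le_1[of h] ch in simp)
    then show ?thesis using 1 2 unfolding ch by (simp add: distrib_right)
  qed
  then have sq: "integrable \<mu> (\<lambda>x. x\<^sup>2)"
    by (rule second_moment_of_char[OF \<open>real_distribution \<mu>\<close>])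
  note d = has_vector_derivative_char[OF \<open>real_distribution \<mu>\<close> sq]
  show "integrable \<mu> (\<lambda>x. x)" by (rule d(1))
  have tr: "(CLINT x|\<mu>. x * iexp (u * x)) = a * char (\<mu> \<star> \<alpha>) u" for u
  proof -
    have "(\<Psi> has_vector_derivative \<i> * char \<alpha> u) (at u)"
      by (rule has_vector_derivative_quadratic_remainder[OF b(2)])
    then have "((\<lambda>u. a * \<Psi> u) has_vector_derivative a * (\<i> * char \<alpha> u)) (at u)"
      by (rule has_vector_derivative_mult_right)
    from field_vector_diff_chain_at[OF this DERIV_exp]
    have "(char \<mu> has_vector_derivative a * (\<i> * char \<alpha> u) * exp (a * \<Psi> u)) (at u)"
      by (simp add: o_def ch[symmetric])
    from vector_derivative_unique_at[OF d(2) this] show ?thesis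
      unfolding char_convolution[OF \<open>real_distribution \<mu>\<close> \<open>real_distribution \<alpha>\<close>] ch[symmetric]
      by (simp add: mult_ac)
  qed
  note sb = size_bias_of_transform[OF \<open>real_distribution \<mu>\<close>
      real_distribution_convolution[OF \<open>real_distribution \<mu>\<close> \<open>real_distribution \<alpha>\<close>] d(1) a tr]
  show "AE x in \<mu>. 0 \<le> x" by (rule sb(1))
  show "(\<integral>x. x * indicator A x \<partial>\<mu>) = a * measure (\<mu> \<star> \<alpha>) A" if "A \<in> sets borel"
    by (rule sb(2)[OF that])
qed

section \<open>Iterating the size-bias identity\<close>

text \<open>Both steps bound \<open>x\<close> on an interval by an endpoint and read off the size-bias identity. Adding an
  independent variable with values in \<open>{0..c}\<close> can reach \<open>{x..}\<close> only from \<open>{x - c..}\<close>. Conversely,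
  an increment in \<open>{d..c}\<close> carries \<open>{l..<r}\<close> into \<open>{l + d..<r + c}\<close>. In this second
  step the interval has to be bounded on the right, as otherwise \<open>x\<close> would have no upper bound on
  it; the price is that its length grows by \<open>c - d\<close>.\<close>

lemma
  fixes \<mu> \<alpha> :: "real measure" and a c :: real
  assumes "real_distribution \<mu>" and "real_distribution \<alpha>" and supp: "measure \<alpha> {0..c} = 1"
    and a: "a > 0" and int: "integrable \<mu> (\<lambda>x. x)"
    and sb: "\<And>A. A \<in> sets borel \<Longrightarrow> (\<integral>x. x * indicator A x \<partial>\<mu>) = a * measure (\<mu> \<star> \<alpha>) A"
  shows size_bias_tail_step: "x > 0 \<Longrightarrow> measure \<mu> {x..} \<le> a / x * measure \<mu> {x - c..}"
    and size_bias_interval_step: "r + c > 0 \<Longrightarrow>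
      a * measure \<alpha> {d..c} / (r + c) * measure \<mu> {l..<r} \<le> measure \<mu> {l + d..<r + c}"
proof -
  interpret real_distribution \<mu> by fact
  have ii: "integrable \<mu> (\<lambda>x. x * indicator A x)" if [measurable]: "A \<in> sets borel" for A
    by (rule Bochner_Integration.integrable_bound[OF int]) (auto split: split_indicator)
  have ic: "integrable \<mu> (\<lambda>z. k * indicator A z)" if [measurable]: "A \<in> sets borel" for A and k :: real
    by (rule integrable_const_bound[where B="\<bar>k\<bar>"]) (auto split: split_indicator)
  show "measure \<mu> {x..} \<le> a / x * measure \<mu> {x - c..}" if "x > 0"
  proof -
    have "x * measure \<mu> {x..} = (\<integral>z. x * indicator {x..} z \<partial>\<mu>)" by simp
    also have "\<dots> \<le> (\<integral>z. z * indicator {x..} z \<partial>\<mu>)"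
      by (rule integral_mono[OF ic ii]) (auto split: split_indicator)
    also have "\<dots> = a * measure (\<mu> \<star> \<alpha>) {x..}" by (rule sb) simp
    also have "measure (\<mu> \<star> \<alpha>) {x..} \<le> measure \<mu> {x - c..}"
      by (rule measure_convolution_le[where C="{0..c}"]) (use assms(1,2) supp in auto)
    finally show ?thesis using a that by (simp add: field_simps)
  qed
  show "a * measure \<alpha> {d..c} / (r + c) * measure \<mu> {l..<r} \<le> measure \<mu> {l + d..<r + c}" if "r + c > 0"
  proof -
    have "measure \<mu> {l..<r} * measure \<alpha> {d..c} \<le> measure (\<mu> \<star> \<alpha>) {l + d..<r + c}"
      by (rule measure_convolution_ge) (use assms(1,2) in auto)
    then have "a * measure \<alpha> {d..c} * measure \<mu> {l..<r} \<le> a * measure (\<mu> \<star> \<alpha>) {l + d..<r + c}"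
      using a by (simp add: mult_ac)
    also have "\<dots> = (\<integral>z. z * indicator {l + d..<r + c} z \<partial>\<mu>)" by (rule sb[symmetric]) simp
    also have "\<dots> \<le> (\<integral>z. (r + c) * indicator {l + d..<r + c} z \<partial>\<mu>)"
      by (rule integral_mono[OF ii ic]) (auto split: split_indicator)
    also have "\<dots> = (r + c) * measure \<mu> {l + d..<r + c}" by simp
    finally show ?thesis using that by (simp add: field_simps)
  qed
qed

text \<open>All arguments met in the first \<open>k\<close> steps stay above \<open>y\<close>, so every factor is at most
  \<open>a / y\<close>.\<close>

lemma tail_iterate:
  fixes G :: "real \<Rightarrow> real"
  assumes step: "\<And>x. x > 0 \<Longrightarrow> G x \<le> a / x * G (x - c)" and G: "\<And>x. 0 \<le> G x" "\<And>x. G x \<le> 1"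
    and "a > 0" "c \<ge> 0" "y > 0"
  shows "y \<le> x - real k * c \<Longrightarrow> G x \<le> (a / y) ^ k"
proof (induction k arbitrary: x)
  case (Suc k)
  have "0 \<le> real (Suc k) * c" using \<open>c \<ge> 0\<close> by simp
  then have xy: "y \<le> x" using Suc.prems by linarith
  with \<open>y > 0\<close> have "G x \<le> a / x * G (x - c)" by (intro step) simp
  also have "\<dots> \<le> a / y * (a / y) ^ k"
    using Suc xy assms by (intro mult_mono Suc.IH divide_left_mono) (auto simp: algebra_simps)
  finally show ?case by simp
qed (simp add: G)

text \<open>All right endpoints met in the first \<open>k\<close> steps stay below \<open>R\<close>, so every factor is at least
  \<open>b / R\<close>.\<close>

lemma interval_iterate:
  fixes F :: "real \<Rightarrow> real \<Rightarrow> real"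
  assumes step: "\<And>l r. r + c > 0 \<Longrightarrow> b / (r + c) * F l r \<le> F (l + d) (r + c)"
    and F: "\<And>l r. 0 \<le> F l r" and "b > 0" "c > 0" "H > 0"
  shows "H + real k * c \<le> R \<Longrightarrow> (b / R) ^ k * F 0 H \<le> F (real k * d) (H + real k * c)"
proof (induction k)
  case (Suc k)
  have pos: "0 < H + real k * c + c" using assms by (intro add_nonneg_pos add_nonneg_nonneg) auto
  have le: "H + real k * c + c \<le> R" using Suc.prems by (simp add: algebra_simps)
  have "(b / R) ^ Suc k * F 0 H = b / R * ((b / R) ^ k * F 0 H)" by simp
  also have "\<dots> \<le> b / (H + real k * c + c) * F (real k * d) (H + real k * c)"
    using pos le Suc F assms by (intro mult_mono Suc.IH divide_left_mono) auto
  also have "\<dots> \<le> F (real k * d + d) (H + real k * c + c)" by (rule step[OF pos])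
  finally show ?case by (simp add: algebra_simps)
qed simp

section \<open>Logarithmic asymptotics of the tail\<close>

text \<open>Take \<open>y = \<delta> x\<close>: about \<open>(1 - \<delta>) x / c\<close> steps lead from \<open>x\<close> down to \<open>\<delta> x\<close>. Stopping at a fixed
  fraction of \<open>x\<close> loses only the factor \<open>1 - \<delta>\<close>, because each step still contributes
  \<open>ln x\<close> up to a constant.\<close>

lemma log_tail_upper:
  fixes G :: "real \<Rightarrow> real"
  assumes bnd: "\<And>x y k. y > 0 \<Longrightarrow> y \<le> x - real k * c \<Longrightarrow> G x \<le> (a / y) ^ k"
    and pos: "\<And>x. 0 < G x" and "a > 0" "c > 0" and \<delta>: "0 < \<delta>" "\<delta> < 1"
  shows "eventually (\<lambda>x. ln (G x) \<le> - ((1 - \<delta>) * x / c - 1) * ln (\<delta> * x / a)) at_top"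
  using eventually_gt_at_top[of "a / \<delta>"]
proof eventually_elim
  case (elim x)
  then have big: "\<delta> * x / a > 1" using \<delta> \<open>a > 0\<close> by (simp add: field_simps)
  have "0 < a / \<delta>" using \<delta> \<open>a > 0\<close> by simp
  with elim have "x > 0" by linarith
  define k where "k = nat \<lfloor>(1 - \<delta>) * x / c\<rfloor>"
  have "0 \<le> (1 - \<delta>) * x / c" using \<delta> \<open>x > 0\<close> \<open>c > 0\<close> by simp
  then have k: "real k \<le> (1 - \<delta>) * x / c" "(1 - \<delta>) * x / c - 1 \<le> real k"
    unfolding k_def by (auto simp: le_nat_floor)
  have "\<delta> * x \<le> x - real k * c" using k(1) \<open>c > 0\<close> by (simp add: field_simps)
  then have "G x \<le> (a / (\<delta> * x)) ^ k" using \<delta> \<open>x > 0\<close> by (intro bnd) auto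
  then have "ln (G x) \<le> ln ((a / (\<delta> * x)) ^ k)" using pos by (intro ln_mono) auto
  also have "\<dots> = - real k * ln (\<delta> * x / a)"
    using \<delta> \<open>x > 0\<close> \<open>a > 0\<close> by (simp add: ln_realpow ln_div algebra_simps)
  also have "\<dots> \<le> - ((1 - \<delta>) * x / c - 1) * ln (\<delta> * x / a)"
    using k(2) big by (intro mult_right_mono) auto
  finally show ?case .
qed

text \<open>About \<open>x / d\<close> steps of length \<open>d\<close> reach \<open>x\<close>, and the right endpoints stay below a linear
  function \<open>R\<close> of \<open>x\<close>, so each step costs \<open>ln R\<close>, which is \<open>ln x\<close> up to a constant.\<close>

lemma log_tail_lower:
  fixes G :: "real \<Rightarrow> real"
  assumes bnd: "\<And>k R. H + real k * c \<le> R \<Longrightarrow> (b / R) ^ k * p \<le> G (real k * d)"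
    and anti: "\<And>x y. x \<le> y \<Longrightarrow> G y \<le> G x"
    and "b > 0" "c > 0" "H > 0" "d > 0" "p > 0"
  shows "eventually (\<lambda>x. ln p - (x / d + 1) * ln ((H + c * (x / d + 1)) / b) \<le> ln (G x)) at_top"
  using eventually_gt_at_top[of "d * (b / c)"]
proof eventually_elim
  case (elim x)
  have "0 < d * (b / c)" using assms by simp
  with elim have "x > 0" by linarith
  define R where "R = H + c * (x / d + 1)"
  have "c * (x / d) > b" using elim assms by (simp add: field_simps)
  then have "R > b" using assms unfolding R_def distrib_left by linarith
  then have big: "R / b > 1" "R > 0" using \<open>b > 0\<close> by auto
  define k where "k = nat \<lceil>x / d\<rceil>"
  have k: "x / d \<le> real k" "real k \<le> x / d + 1"
    unfolding k_def using \<open>x > 0\<close> \<open>d > 0\<close> by (auto simp: real_nat_ceiling_ge)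
  have "H + real k * c \<le> R" unfolding R_def using k(2) \<open>c > 0\<close> by (simp add: mult.commute)
  then have "(b / R) ^ k * p \<le> G (real k * d)" by (rule bnd)
  also have "\<dots> \<le> G x" using k(1) \<open>d > 0\<close> by (intro anti) (simp add: field_simps)
  finally have "ln ((b / R) ^ k * p) \<le> ln (G x)" using big assms by (intro ln_mono) auto
  moreover have "ln ((b / R) ^ k * p) = ln p - real k * ln (R / b)"
    using big assms by (simp add: ln_mult ln_realpow ln_div algebra_simps)
  moreover have "real k * ln (R / b) \<le> (x / d + 1) * ln (R / b)"
    using k(2) big by (intro mult_right_mono) auto
  ultimately show ?case unfolding R_def by linarith
qed

text \<open>After division by \<open>(x / c) ln x\<close> the bounds tend to \<open>- (1 - \<delta>)\<close> and \<open>- c / d\<close>; letting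
  \<open>\<delta>\<close> decrease to \<open>0\<close> and \<open>d\<close> increase to \<open>c\<close> squeezes the quotient to \<open>-1\<close>.\<close>

lemma log_tail_limit:
  fixes L :: "real \<Rightarrow> real"
  assumes "a > 0" "c > 0"
    and upper: "\<And>\<delta>. 0 < \<delta> \<Longrightarrow> \<delta> < 1 \<Longrightarrow>
      eventually (\<lambda>x. L x \<le> - ((1 - \<delta>) * x / c - 1) * ln (\<delta> * x / a)) at_top"
    and lower: "\<And>d. 0 < d \<Longrightarrow> d < c \<Longrightarrow> \<exists>C H b. H > 0 \<and> b > 0 \<and>
      eventually (\<lambda>x. C - (x / d + 1) * ln ((H + c * (x / d + 1)) / b) \<le> L x) at_top"
  shows "((\<lambda>x. L x / ((x / c) * ln x)) \<longlongrightarrow> -1) at_top"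
proof (rule order_tendstoI)
  fix l :: real assume l: "l < -1"
  \<comment> \<open>any \<open>d\<close> with \<open>c / (- l) < d < c\<close> serves; this is the midpoint\<close>
  define d where "d = (c + c / (- l)) / 2"
  have d: "0 < d" "d < c" "l < - (c / d)"
  proof -
    have "0 < c / (- l)" "c / (- l) < c" using l \<open>c > 0\<close> mult_strict_left_mono[OF l \<open>c > 0\<close>] by (auto simp: field_simps)
    then show "0 < d" "d < c" by (auto simp: d_def)
    have "t < (c + t) / 2" if "t < c" for t using that by simp
    from this[OF \<open>c / (- l) < c\<close>] have "c / (- l) < d" unfolding d_def .
    then show "l < - (c / d)" using \<open>0 < d\<close> l by (simp add: field_simps)
  qed
  obtain C H b where Hb: "H > 0" "b > 0" and
    ev: "eventually (\<lambda>x. C - (x / d + 1) * ln ((H + c * (x / d + 1)) / b) \<le> L x) at_top"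
    using lower[OF d(1,2)] by blast
  have "((\<lambda>x. (C - (x / d + 1) * ln ((H + c * (x / d + 1)) / b)) / ((x / c) * ln x)) \<longlongrightarrow> - (c / d)) at_top"
    using \<open>c > 0\<close> d(1) Hb by (real_asymp simp: field_simps)
  from order_tendstoD(1)[OF this d(3)] ev eventually_gt_at_top[of 1]
  show "eventually (\<lambda>x. l < L x / ((x / c) * ln x)) at_top"
  proof eventually_elim
    case (elim x)
    then have "0 < (x / c) * ln x" using \<open>c > 0\<close> by simp
    from divide_right_mono[OF elim(2) less_imp_le[OF this]] elim(1) show ?case by simp
  qed
next
  fix u :: real assume u: "-1 < u"
  define \<delta> where "\<delta> = min (1 / 2) ((u + 1) / 2)"
  have \<delta>: "0 < \<delta>" "\<delta> < 1" "- (1 - \<delta>) < u" using u by (auto simp: \<delta>_def min_def field_simps)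
  have "((\<lambda>x. (- ((1 - \<delta>) * x / c - 1) * ln (\<delta> * x / a)) / ((x / c) * ln x)) \<longlongrightarrow> - (1 - \<delta>)) at_top"
    using \<open>c > 0\<close> \<open>a > 0\<close> \<delta>(1,2) by (real_asymp simp: field_simps)
  from order_tendstoD(2)[OF this \<delta>(3)] upper[OF \<delta>(1,2)] eventually_gt_at_top[of 1]
  show "eventually (\<lambda>x. L x / ((x / c) * ln x) < u) at_top"
  proof eventually_elim
    case (elim x)
    then have "0 < (x / c) * ln x" using \<open>c > 0\<close> by simp
    from divide_right_mono[OF elim(2) less_imp_le[OF this]] elim(1) show ?case by simp
  qed
qed

theorem theorem6p1:
  fixes c a :: real and \<alpha> :: "real measure" and M :: "'a measure" and X :: "'a \<Rightarrow> real"
  assumes "c > 0" and "a > 0"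
    and "real_distribution \<alpha>" and "measure \<alpha> {0..c} = 1"
    and "\<And>\<epsilon>. \<epsilon> > 0 \<Longrightarrow> measure \<alpha> {0..c - \<epsilon>} < 1"
    and "prob_space M" and "X \<in> borel_measurable M"
    and "\<And>u::real. char (distr M borel X) u =
           exp (of_real a * (\<i> * of_real u * of_real (measure \<alpha> {0})
             + (CLINT y:{0<..c}|\<alpha>. (iexp (u * y) - 1) / of_real y)))"
  shows "((\<lambda>x::real. ln (measure M {\<omega> \<in> space M. X \<omega> \<ge> x}) / ((x / c) * ln x)) \<longlongrightarrow> -1) at_top"
proof -
  interpret M: prob_space M by fact
  note [measurable] = \<open>X \<in> borel_measurable M\<close>
  define \<mu> where "\<mu> = distr M borel X"
  define G where "G x = measure \<mu> {x..}" for x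
  have rd: "real_distribution \<mu>" unfolding \<mu>_def by (rule M.real_distribution_distr) simp
  interpret real_distribution \<mu> by (rule rd)
  interpret \<alpha>: real_distribution \<alpha> by fact
  have GX: "measure M {\<omega> \<in> space M. X \<omega> \<ge> x} = G x" for x
    unfolding G_def \<mu>_def by (subst measure_distr) (auto intro!: arg_cong[where f="measure M"])
  have "char \<mu> u = exp (a * (CLINT y|\<alpha>. levy_kernel u y))" for u
    unfolding \<mu>_def assms(8) levy_exponent_eq_integral[OF assms(3,4)] ..
  note law = integrable_of_levy_char[OF rd assms(3,4,2) this] nonneg_of_levy_char[OF rd assms(3,4,2) this]
    size_bias_of_levy_char[OF rd assms(3,4,2) this]
  note steps = size_bias_tail_step[OF rd assms(3,4,2) law(1,3)]
    size_bias_interval_step[OF rd assms(3,4,2) law(1,3)]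
  have lower: "\<exists>p H b. p > 0 \<and> H > 0 \<and> b > 0 \<and>
      (\<forall>k R. H + real k * c \<le> R \<longrightarrow> (b / R) ^ k * p \<le> G (real k * d))"
    if d: "0 < d" "d < c" for d
  proof -
    \<comment> \<open>as \<open>d < c\<close>, the interval \<open>{0..d}\<close> does not carry all of \<open>\<alpha>\<close>\<close>
    have "measure \<alpha> {0..c} \<le> measure \<alpha> ({0..d} \<union> {d..c})"
      by (rule \<alpha>.finite_measure_mono) auto
    also have "\<dots> \<le> measure \<alpha> {0..d} + measure \<alpha> {d..c}"
      by (rule measure_Un_le) auto
    finally have \<beta>: "measure \<alpha> {d..c} > 0"
      using assms(4) assms(5)[of "c - d"] d by simp
    \<comment> \<open>a bounded starting interval of positive mass for the iteration\<close>
    have "(\<lambda>n. measure \<mu> {0..<real (Suc n)}) \<longlonglongrightarrow> measure \<mu> (\<Union>n. {0..<real (Suc n)})"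
      by (rule finite_Lim_measure_incseq) (auto simp: incseq_def)
    moreover have "(\<Union>n. {0..<real (Suc n)}) = {0..}"
    proof (intro set_eqI iffI)
      fix x :: real assume "x \<in> {0..}"
      moreover obtain n where "x < real n" using reals_Archimedean2 by blast
      ultimately show "x \<in> (\<Union>n. {0..<real (Suc n)})" by (auto intro!: exI[of _ n])
    qed auto
    moreover have "measure \<mu> {0..} = 1"
      using prob_eq_1[of "{0..}"] law(2) by simp
    ultimately have "(\<lambda>n. measure \<mu> {0..<real (Suc n)}) \<longlonglongrightarrow> 1" by simp
    from order_tendstoD(1)[OF this zero_less_one] obtain n where
      p: "measure \<mu> {0..<real (Suc n)} > 0"
      by (auto simp: eventually_sequentially)
    have "(a * measure \<alpha> {d..c} / R) ^ k * measure \<mu> {0..<real (Suc n)} \<le> G (real k * d)"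
      if "real (Suc n) + real k * c \<le> R" for k R
    proof -
      have "(a * measure \<alpha> {d..c} / R) ^ k * measure \<mu> {0..<real (Suc n)}
          \<le> measure \<mu> {real k * d..<real (Suc n) + real k * c}"
        by (rule interval_iterate[where F="\<lambda>l r. measure \<mu> {l..<r}"])
          (use that steps(2) \<beta> assms(1,2) in auto)
      also have "\<dots> \<le> G (real k * d)"
        unfolding G_def by (rule finite_measure_mono) auto
      finally show ?thesis .
    qed
    with p \<beta> \<open>a > 0\<close> show ?thesis
      by (intro exI[of _ "measure \<mu> {0..<real (Suc n)}"] exI[of _ "real (Suc n)"]
          exI[of _ "a * measure \<alpha> {d..c}"]) auto
  qed
  have anti: "G y \<le> G x" if "x \<le> y" for x y
    unfolding G_def using that by (intro finite_measure_mono) auto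
  \<comment> \<open>needed because \<open>ln\<close> is monotone on the positive reals only\<close>
  have pos: "0 < G x" for x
  proof -
    obtain p H b where *: "p > 0" "H > 0" "b > 0"
      "\<And>k R. H + real k * c \<le> R \<Longrightarrow> (b / R) ^ k * p \<le> G (real k * (c / 2))"
      using lower[of "c / 2"] \<open>c > 0\<close> by auto
    obtain k where "x / (c / 2) < real k" using reals_Archimedean2 by blast
    then have "x \<le> real k * (c / 2)" using \<open>c > 0\<close> by (simp add: field_simps)
    have "0 < (b / (H + real k * c)) ^ k * p"
      using * \<open>c > 0\<close> by (intro mult_pos_pos zero_less_power divide_pos_pos add_pos_nonneg) auto
    also have "\<dots> \<le> G (real k * (c / 2))" by (rule *(4)) simp
    also have "\<dots> \<le> G x" by (rule anti) fact
    finally show ?thesis .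
  qed
  show ?thesis
    unfolding GX
  proof (rule log_tail_limit[OF \<open>a > 0\<close> \<open>c > 0\<close>])
    fix \<delta> :: real assume "0 < \<delta>" "\<delta> < 1"
    then show "eventually (\<lambda>x. ln (G x) \<le> - ((1 - \<delta>) * x / c - 1) * ln (\<delta> * x / a)) at_top"
    proof (intro log_tail_upper)
      show "G x \<le> (a / y) ^ k" if "y > 0" "y \<le> x - real k * c" for x y k
        by (rule tail_iterate[where c=c]) (use that steps(1) assms(1,2) in \<open>auto simp: G_def\<close>)
    qed (use pos assms(1,2) in auto)
  next
    fix d assume "0 < d" "d < c"
    from lower[OF this] obtain p H b where *: "p > 0" "H > 0" "b > 0"
      and bnd: "\<And>k R. H + real k * c \<le> R \<Longrightarrow> (b / R) ^ k * p \<le> G (real k * d)" by auto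
    have "eventually (\<lambda>x. ln p - (x / d + 1) * ln ((H + c * (x / d + 1)) / b) \<le> ln (G x)) at_top"
      by (rule log_tail_lower[OF bnd anti]) (use * \<open>c > 0\<close> \<open>0 < d\<close> in auto)
    with * show "\<exists>C H b. H > 0 \<and> b > 0 \<and>
        eventually (\<lambda>x. C - (x / d + 1) * ln ((H + c * (x / d + 1)) / b) \<le> ln (G x)) at_top"
      by (intro exI conjI)
  qed
qed

end
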